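(* If $G$ and $H$ are digraphs, then \[\gamma(G\mathbin{\Box} H)\ge\frac12\gamma(G)\gamma(H)+\frac12\max\{\gamma(G),\gamma(H)\},\] and the bound is sharp, i.e., there exist digraphs $G$ and $H$ for which equality holds.
   Context: All digraphs are finite, and their arc relation is irreflexive. A set $S\subseteq V(D)$ is dominating if every vertex not in $S$ is an out-neighbor of some vertex of $S$; $\gamma(D)$ is the minimum size of a dominating set. The Cartesian product $G\mathbin{\Box} H$ has vertex set $V(G)\times V(H)$, with an arc from $(g_1,h_1)$ to $(g_2,h_2)$ iff either $g_1=g_2$ and $h_1h_2\in A(H)$, or $h_1=h_2$ and $g_1g_2\in A(G)$. *)

theory Defs
  imports Complex_Main "Graph_Theory.Pair_Digraph"
begin

text \<open>
  A digraph is a \<open>pair_digraph\<close>: finitely many vertices, arcs given as a set of ordered pairs of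
  vertices, no loops; opposite arcs may both be present.
\<close>

definition dominating :: "'a pair_pre_digraph \<Rightarrow> 'a set \<Rightarrow> bool" where
  "dominating D S \<longleftrightarrow> S \<subseteq> pverts D \<and> (\<forall>v \<in> pverts D - S. \<exists>u \<in> S. (u, v) \<in> parcs D)"

definition domination_number :: "'a pair_pre_digraph \<Rightarrow> nat" where
  "domination_number D = (LEAST n. \<exists>S. dominating D S \<and> card S = n)"

text \<open>The conditions \<open>g1 \<in> pverts G\<close> and \<open>h1 \<in> pverts H\<close> keep the arcs inside the vertex set.\<close>

definition cartesian_product ::
  "'a pair_pre_digraph \<Rightarrow> 'b pair_pre_digraph \<Rightarrow> ('a \<times> 'b) pair_pre_digraph"
  (infixr \<open>\<box>\<close> 70) where
  "G \<box> H = \<lparr> pverts = pverts G \<times> pverts H,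
     parcs = {((g1, h1), (g2, h2)) | g1 h1 g2 h2.
       (g1 \<in> pverts G \<and> g1 = g2 \<and> (h1, h2) \<in> parcs H) \<or>
       (h1 \<in> pverts H \<and> h1 = h2 \<and> (g1, g2) \<in> parcs G)} \<rparr>"

lemma pair_digraph_cartesian_product:
  assumes "pair_digraph G" "pair_digraph H"
  shows "pair_digraph (G \<box> H)"
proof -
  interpret G: pair_digraph G by fact
  interpret H: pair_digraph H by fact
  have wf: "parcs (G \<box> H) \<subseteq> (pverts G \<times> pverts H) \<times> (pverts G \<times> pverts H)"
    by (auto simp: cartesian_product_def dest: G.in_arcsD1 G.in_arcsD2 H.in_arcsD1 H.in_arcsD2)
  have fin: "finite (pverts G \<times> pverts H)"
    using G.pair_finite_verts H.pair_finite_verts by simp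
  have verts: "pverts (G \<box> H) = pverts G \<times> pverts H"
    by (simp add: cartesian_product_def)
  show ?thesis
  proof
    show "fst e \<in> pverts (G \<box> H)" "snd e \<in> pverts (G \<box> H)" if "e \<in> parcs (G \<box> H)" for e
      using subsetD[OF wf that] unfolding verts by (simp_all only: mem_Times_iff)
    show "finite (pverts (G \<box> H))"
      unfolding verts by (rule fin)
    show "finite (parcs (G \<box> H))"
      using wf by (rule finite_subset) (intro finite_cartesian_product fin)
    show "fst e \<noteq> snd e" if "e \<in> parcs (G \<box> H)" for e
      using that by (auto simp: cartesian_product_def dest: G.pair_no_loops H.pair_no_loops)
  qed
qed

end

theory Submission
  imports Defs
begin

text \<open>
  Let \<open>D\<close> dominate \<open>G \<box> H\<close> and let \<open>U\<close> be a smallest dominating set of \<open>G\<close> inside the projection of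
  \<open>D\<close> to \<open>G\<close>. Partition \<open>V(G)\<close> into classes, one around each \<open>u \<in> U\<close> and dominated by \<open>u\<close>. The
  projection \<open>P u\<close> to \<open>H\<close> of the part of \<open>D\<close> above the class of \<open>u\<close>, together with the set \<open>C u\<close> of
  vertices that \<open>P u\<close> leaves undominated, dominates \<open>H\<close>; summing over \<open>u\<close>, \<open>D\<close> plus the pairs
  \<open>(u, h)\<close> with \<open>h \<in> C u\<close> number at least \<open>|U| \<gamma>(H)\<close>. For fixed \<open>h\<close>, every class with \<open>h \<in> C u\<close> is
  dominated by the layer of \<open>D\<close> at height \<open>h\<close>, so this layer can replace those \<open>u\<close> in \<open>U\<close>. The result
  still lies in the projection of \<open>D\<close>, so it has at least \<open>|U|\<close> elements; hence there are at most
  as many such \<open>u\<close> as there are points of the layer outside \<open>U\<close>. Since every element of \<open>U\<close> occurs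
  in some layer, summing over \<open>h\<close> gives \<open>2 |D| \<ge> |U| \<gamma>(H) + |U|\<close>.
\<close>

section \<open>Dominating sets and the domination number\<close>

lemma dominatingI:
  assumes "S \<subseteq> pverts D"
    and "\<And>v. v \<in> pverts D \<Longrightarrow> v \<notin> S \<Longrightarrow> \<exists>u\<in>S. (u, v) \<in> parcs D"
  shows "dominating D S"
  using assms by (auto simp: dominating_def)

lemma dominating_subset: "dominating D S \<Longrightarrow> S \<subseteq> pverts D"
  by (simp add: dominating_def)

lemma dominatingE:
  assumes "dominating D S" "v \<in> pverts D"
  obtains "v \<in> S" | u where "u \<in> S" "(u, v) \<in> parcs D"
  using assms by (auto simp: dominating_def)

lemma domination_number_le: "dominating D S \<Longrightarrow> domination_number D \<le> card S"
  unfolding domination_number_def by (rule Least_le) blast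

lemma domination_number_attained:
  obtains S where "dominating D S" "card S = domination_number D"
proof -
  have "dominating D (pverts D)"
    by (simp add: dominating_def)
  then have "\<exists>n S. dominating D S \<and> card S = n"
    by blast
  from LeastI_ex[OF this] obtain S where "dominating D S" "card S = domination_number D"
    unfolding domination_number_def by blast
  then show ?thesis
    by (rule that)
qed

section \<open>Domination in Cartesian products\<close>

lemma pverts_cartesian_product [simp]: "pverts (G \<box> H) = pverts G \<times> pverts H"
  by (simp add: cartesian_product_def)

lemma parcs_cartesian_product_iff:
  "((g1, h1), (g2, h2)) \<in> parcs (G \<box> H) \<longleftrightarrow>
     g1 \<in> pverts G \<and> g1 = g2 \<and> (h1, h2) \<in> parcs H \<or>
     h1 \<in> pverts H \<and> h1 = h2 \<and> (g1, g2) \<in> parcs G"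
  by (simp add: cartesian_product_def)

lemma dominating_cartesian_productE:
  assumes "dominating (G \<box> H) D" "g \<in> pverts G" "h \<in> pverts H"
  obtains "(g, h) \<in> D"
    | g' where "(g', h) \<in> D" "(g', g) \<in> parcs G"
    | h' where "(g, h') \<in> D" "(h', h) \<in> parcs H"
proof -
  have "(g, h) \<in> pverts (G \<box> H)"
    using assms(2,3) by simp
  with assms(1) show ?thesis
  proof (rule dominatingE)
    fix u assume "u \<in> D" "(u, (g, h)) \<in> parcs (G \<box> H)"
    then show ?thesis
      using that(2,3) by (cases u) (auto simp: parcs_cartesian_product_iff)
  qed (rule that(1))
qed

text \<open>The counting bound below is asymmetric in the factors; this symmetry supplies its mirror
  image.\<close>

lemma dominating_cartesian_product_swap:
  assumes "dominating (G \<box> H) D"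
  shows "dominating (H \<box> G) (prod.swap ` D)"
proof (rule dominatingI)
  show "prod.swap ` D \<subseteq> pverts (H \<box> G)"
    using dominating_subset[OF assms] by auto
next
  fix v assume v: "v \<in> pverts (H \<box> G)" "v \<notin> prod.swap ` D"
  then obtain h g where [simp]: "v = (h, g)" and gh: "g \<in> pverts G" "h \<in> pverts H"
    by auto
  have swap_D: "(y, x) \<in> prod.swap ` D" if "(x, y) \<in> D" for x y
    using that by force
  from assms gh show "\<exists>u\<in>prod.swap ` D. (u, v) \<in> parcs (H \<box> G)"
  proof (rule dominating_cartesian_productE)
    assume "(g, h) \<in> D"
    then show ?thesis
      using v(2) swap_D by simp
  next
    fix g' assume "(g', h) \<in> D" "(g', g) \<in> parcs G"
    then show ?thesis
      using gh by (intro bexI[OF _ swap_D]) (auto simp: parcs_cartesian_product_iff)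
  next
    fix h' assume "(g, h') \<in> D" "(h', h) \<in> parcs H"
    then show ?thesis
      using gh by (intro bexI[OF _ swap_D]) (auto simp: parcs_cartesian_product_iff)
  qed
qed

text \<open>Fix any height \<open>h\<close>. If \<open>g\<close> is outside the projection, no
  element of \<open>D\<close> has first coordinate \<open>g\<close>, so \<open>(g, h)\<close> can
  only be dominated along an arc of \<open>G\<close>.\<close>

lemma dominating_projection:
  assumes D: "dominating (G \<box> H) D" and "pverts H \<noteq> {}"
  shows "dominating G (fst ` D)"
proof (rule dominatingI)
  show "fst ` D \<subseteq> pverts G"
    using dominating_subset[OF D] by auto
next
  fix g assume g: "g \<in> pverts G" "g \<notin> fst ` D"
  obtain h where "h \<in> pverts H"
    using assms(2) by blast
  with D g(1) show "\<exists>u\<in>fst ` D. (u, g) \<in> parcs G"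
    by (rule dominating_cartesian_productE) (use g(2) in force)+
qed

section \<open>The lower bound by double counting\<close>

lemma dominating_cartesian_product_card_ge:
  fixes G :: "'a pair_pre_digraph" and H :: "'b pair_pre_digraph"
  assumes "finite (pverts G)" "finite (pverts H)" "pverts H \<noteq> {}"
    and D: "dominating (G \<box> H) D"
  shows "domination_number G * domination_number H + domination_number G \<le> 2 * card D"
proof -
  have D_sub: "D \<subseteq> pverts G \<times> pverts H"
    using dominating_subset[OF D] by simp
  then have finD: "finite D"
    using assms(1,2) finite_subset by blast
  \<comment> \<open>\<open>U\<close> is smallest only among dominating subsets of the projection, so
    \<open>card U\<close> may exceed \<open>domination_number G\<close>. Lying in the projection
    puts every element of \<open>U\<close> into some layer, as \<open>sum_U\<close> needs.\<close>
  obtain U where U: "U \<subseteq> fst ` D" "dominating G U"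
    and U_min: "\<And>T. T \<subseteq> fst ` D \<Longrightarrow> dominating G T \<Longrightarrow> card U \<le> card T"
    using ex_has_least_nat[of "\<lambda>T. T \<subseteq> fst ` D \<and> dominating G T" "fst ` D" card]
      dominating_projection[OF D assms(3)] by blast
  have finU: "finite U"
    using U(1) finD finite_surj by blast
  \<comment> \<open>The classes are the fibres of \<open>f\<close>; each \<open>u \<in> U\<close>
    belongs to its own class.\<close>
  have "\<exists>u\<in>U. (g \<in> U \<longrightarrow> u = g) \<and> (u = g \<or> (u, g) \<in> parcs G)" if "g \<in> pverts G" for g
    using U(2) that by (rule dominatingE) blast+
  then obtain f where f_U: "\<And>g. g \<in> pverts G \<Longrightarrow> f g \<in> U"
    and f_fix: "\<And>g. g \<in> pverts G \<Longrightarrow> g \<in> U \<Longrightarrow> f g = g"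
    and f_arc: "\<And>g. g \<in> pverts G \<Longrightarrow> f g = g \<or> (f g, g) \<in> parcs G"
    by metis

  define P where "P u = {h. \<exists>g. (g, h) \<in> D \<and> f g = u}" for u
  define C where "C u = {h \<in> pverts H. h \<notin> P u \<and> (\<forall>h'\<in>P u. (h', h) \<notin> parcs H)}" for u
  \<comment> \<open>\<open>R h\<close> is the layer of \<open>D\<close> at height \<open>h\<close>,
    and \<open>S h\<close> consists of the elements of \<open>U\<close> that this layer can
    replace.\<close>
  define S where "S h = {u \<in> U. h \<in> C u}" for h
  define R where "R h = {g. (g, h) \<in> D}" for h

  have P_sub: "P u \<subseteq> pverts H" for u
    using D_sub by (auto simp: P_def)
  have C_sub: "C u \<subseteq> pverts H" for u
    by (auto simp: C_def)
  have R_sub: "R h \<subseteq> fst ` D" for h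
    by (force simp: R_def)
  have finP: "finite (P u)" for u
    using P_sub assms(2) by (rule finite_subset)
  have finC: "finite (C u)" for u
    using C_sub assms(2) by (rule finite_subset)
  have finR: "finite (R h)" for h
    using R_sub finD by (rule finite_subset[OF _ finite_imageI])
  have finS: "finite (S h)" for h
    using finU by (simp add: S_def)

  have row: "domination_number H \<le> card (P u) + card (C u)" for u
  proof -
    have "dominating H (P u \<union> C u)"
      by (rule dominatingI) (use P_sub C_sub in \<open>auto simp: C_def\<close>)
    then show ?thesis
      using domination_number_le card_Un_le le_trans by blast
  qed

  have layer: "card (U \<inter> R h) + card (S h) \<le> card (R h)" if h: "h \<in> pverts H" for h
  proof -
    have S_U: "S h \<subseteq> U"
      by (auto simp: S_def)
    have UR: "U \<inter> R h \<subseteq> U - S h"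
    proof
      fix u assume u: "u \<in> U \<inter> R h"
      then have "(u, h) \<in> D"
        by (simp add: R_def)
      moreover from this have "f u = u"
        using u D_sub f_fix by blast
      ultimately have "h \<in> P u"
        by (auto simp: P_def)
      then show "u \<in> U - S h"
        using u by (simp add: S_def C_def)
    qed
    have "dominating G (R h \<union> (U - S h))"
    proof (rule dominatingI)
      show "R h \<union> (U - S h) \<subseteq> pverts G"
        using R_sub U(1) D_sub by fastforce
    next
      fix g assume g: "g \<in> pverts G" "g \<notin> R h \<union> (U - S h)"
      show "\<exists>u\<in>R h \<union> (U - S h). (u, g) \<in> parcs G"
      proof (cases "f g \<in> S h")
        case False
        then show ?thesis
          using f_U[OF g(1)] f_arc[OF g(1)] g(2) by (metis DiffI UnI2)
      next
        \<comment> \<open>\<open>h \<in> C (f g)\<close> excludes domination along an arc of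
          \<open>H\<close>: its source \<open>(g, h')\<close> would give
          \<open>h' \<in> P (f g)\<close>. So the layer dominates \<open>g\<close>.\<close>
        case True
        then have C: "h \<in> C (f g)"
          by (simp add: S_def)
        from D g(1) h show ?thesis
        proof (rule dominating_cartesian_productE)
          assume "(g, h) \<in> D"
          then show ?thesis
            using g(2) by (simp add: R_def)
        next
          fix g' assume "(g', h) \<in> D" "(g', g) \<in> parcs G"
          then show ?thesis
            by (auto simp: R_def)
        next
          fix h' assume "(g, h') \<in> D" "(h', h) \<in> parcs H"
          then show ?thesis
            using C by (auto simp: C_def P_def)
        qed
      qed
    qed
    moreover have "R h \<union> (U - S h) \<subseteq> fst ` D"
      using R_sub U(1) by blast
    ultimately have "card U \<le> card (R h \<union> (U - S h))"
      using U_min by blast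
    \<comment> \<open>The points of \<open>U \<inter> R h\<close> already lie in
      \<open>U - S h\<close>. Not counting them twice is what produces the extra summand
      \<open>card U\<close> in the end.\<close>
    also have "R h \<union> (U - S h) = (R h - U \<inter> R h) \<union> (U - S h)"
      using UR by blast
    also have "card \<dots> \<le> card (R h - U \<inter> R h) + card (U - S h)"
      by (rule card_Un_le)
    also have "\<dots> = (card (R h) - card (U \<inter> R h)) + (card U - card (S h))"
      using S_U finS finU by (simp add: card_Diff_subset)
    finally show ?thesis
      using card_mono[OF finU S_U] card_mono[OF finR, of "U \<inter> R h" h] by auto
  qed

  have sum_P: "(\<Sum>u\<in>U. card (P u)) \<le> card D"
  proof -
    \<comment> \<open>Points of \<open>D\<close> at the same height and in the same class collapse
      to one pair, hence only an inequality.\<close>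
    have "(SIGMA u:U. P u) \<subseteq> map_prod f id ` D"
      by (force simp: P_def)
    then have "card (SIGMA u:U. P u) \<le> card D"
      using finD by (rule surj_card_le[rotated])
    then show ?thesis
      using finU finP by simp
  qed
  have sum_R: "(\<Sum>h\<in>pverts H. card (R h)) = card D"
  proof -
    have "prod.swap ` D = (SIGMA h:pverts H. R h)"
      using D_sub by (force simp: R_def)
    then have "card (SIGMA h:pverts H. R h) = card D"
      by (metis card_image inj_swap)
    then show ?thesis
      using assms(2) finR by simp
  qed
  have sum_U: "card U \<le> (\<Sum>h\<in>pverts H. card (U \<inter> R h))"
  proof -
    have "U \<subseteq> (\<Union>h\<in>pverts H. U \<inter> R h)"
      using U(1) D_sub by (fastforce simp: R_def)
    then have "card U \<le> card (\<Union>h\<in>pverts H. U \<inter> R h)"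
      using assms(2) finU by (intro card_mono) auto
    also have "\<dots> \<le> (\<Sum>h\<in>pverts H. card (U \<inter> R h))"
      using assms(2) by (rule card_UN_le)
    finally show ?thesis .
  qed
  have sum_S: "(\<Sum>h\<in>pverts H. card (S h)) = (\<Sum>u\<in>U. card (C u))"
  proof -
    have "prod.swap ` (SIGMA h:pverts H. S h) = (SIGMA u:U. C u)"
      using C_sub by (force simp: S_def)
    then have "card (SIGMA h:pverts H. S h) = card (SIGMA u:U. C u)"
      by (metis card_image inj_swap)
    then show ?thesis
      using assms(2) finS finU finC by simp
  qed

  have "card U * domination_number H \<le> (\<Sum>u\<in>U. card (P u) + card (C u))"
    using sum_mono[OF row, of U] by simp
  also have "\<dots> \<le> card D + (\<Sum>h\<in>pverts H. card (S h))"
    using sum_P sum_S by (simp add: sum.distrib)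
  finally have "card U * domination_number H + card U
      \<le> card D + (\<Sum>h\<in>pverts H. card (U \<inter> R h) + card (S h))"
    using sum_U by (simp add: sum.distrib)
  also have "\<dots> \<le> 2 * card D"
    using sum_mono[OF layer] sum_R by fastforce
  finally have "card U * domination_number H + card U \<le> 2 * card D" .
  moreover have "domination_number G * domination_number H + domination_number G
      \<le> card U * domination_number H + card U"
    using domination_number_le[OF U(2)] by (intro add_mono mult_right_mono) auto
  ultimately show ?thesis
    by linarith
qed

text \<open>A minimum dominating set and its swap give the one-sided bound for both orders of the
  factors, hence the maximum.\<close>

lemma domination_number_cartesian_product_ge:
  fixes G :: "'a pair_pre_digraph" and H :: "'b pair_pre_digraph"
  assumes "finite (pverts G)" "pverts G \<noteq> {}" "finite (pverts H)" "pverts H \<noteq> {}"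
  shows "domination_number G * domination_number H + max (domination_number G) (domination_number H)
    \<le> 2 * domination_number (G \<box> H)"
proof -
  obtain D where D: "dominating (G \<box> H) D" "card D = domination_number (G \<box> H)"
    by (rule domination_number_attained)
  have "card (prod.swap ` D) = card D"
    by (metis card_image inj_swap)
  with D(2)
    dominating_cartesian_product_card_ge[OF assms(1,3,4) D(1)]
    dominating_cartesian_product_card_ge[OF assms(3,1,2) dominating_cartesian_product_swap[OF D(1)]]
  show ?thesis
    by (simp add: max_def mult.commute)
qed

section \<open>Sharpness and the final statement\<close>

lemma domination_number_single_vertex:
  assumes "pverts D = {v}"
  shows "domination_number D = 1"
proof -
  have "domination_number D \<le> card {v}"
    by (intro domination_number_le dominatingI) (simp_all add: assms)
  moreover obtain S where S: "dominating D S" "card S = domination_number D"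
    by (rule domination_number_attained)
  moreover have "S \<noteq> {}" "finite S"
    using S(1) assms by (auto simp: dominating_def dest: finite_subset)
  then have "0 < card S"
    by (simp add: card_gt_0_iff)
  ultimately show ?thesis
    by simp
qed

theorem theorem6p2:
  shows "(\<forall>(G :: 'a pair_pre_digraph) (H :: 'b pair_pre_digraph).
            pair_digraph G \<and> pverts G \<noteq> {} \<and> pair_digraph H \<and> pverts H \<noteq> {} \<longrightarrow>
            real (domination_number (G \<box> H)) \<ge>
              1/2 * real (domination_number G) * real (domination_number H)
              + 1/2 * max (real (domination_number G)) (real (domination_number H))) \<and>
         (\<exists>(G :: nat pair_pre_digraph) (H :: nat pair_pre_digraph).
            pair_digraph G \<and> pverts G \<noteq> {} \<and> pair_digraph H \<and> pverts H \<noteq> {} \<and>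
            real (domination_number (G \<box> H)) =
              1/2 * real (domination_number G) * real (domination_number H)
              + 1/2 * max (real (domination_number G)) (real (domination_number H)))"
proof (intro conjI allI impI)
  fix G :: "'a pair_pre_digraph" and H :: "'b pair_pre_digraph"
  assume GH: "pair_digraph G \<and> pverts G \<noteq> {} \<and> pair_digraph H \<and> pverts H \<noteq> {}"
  then have "finite (pverts G)" "finite (pverts H)"
    by (auto intro: pair_fin_digraph.pair_finite_verts pair_digraph.axioms)
  then have "domination_number G * domination_number H
      + max (domination_number G) (domination_number H) \<le> 2 * domination_number (G \<box> H)"
    using GH by (intro domination_number_cartesian_product_ge) auto
  then have "real (domination_number G) * real (domination_number H)
      + max (real (domination_number G)) (real (domination_number H))
      \<le> 2 * real (domination_number (G \<box> H))"
    by (metis of_nat_add of_nat_le_iff of_nat_max of_nat_mult of_nat_numeral)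
  then show "real (domination_number (G \<box> H)) \<ge>
      1/2 * real (domination_number G) * real (domination_number H)
      + 1/2 * max (real (domination_number G)) (real (domination_number H))"
    by simp
next
  \<comment> \<open>The product of one-vertex digraphs has one vertex, so all three domination
    numbers are 1 and both sides equal 1.\<close>
  define K :: "nat pair_pre_digraph" where "K = \<lparr>pverts = {0}, parcs = {}\<rparr>"
  have K: "pair_digraph K" "pverts K = {0}"
    by unfold_locales (simp_all add: K_def)
  then have "domination_number K = 1" "domination_number (K \<box> K) = 1"
    by (simp_all add: domination_number_single_vertex[of _ 0]
        domination_number_single_vertex[of _ "(0, 0)"])
  with K show "\<exists>(G :: nat pair_pre_digraph) (H :: nat pair_pre_digraph).
      pair_digraph G \<and> pverts G \<noteq> {} \<and> pair_digraph H \<and> pverts H \<noteq> {} \<and>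
      real (domination_number (G \<box> H)) =
        1/2 * real (domination_number G) * real (domination_number H)
        + 1/2 * max (real (domination_number G)) (real (domination_number H))"
    by (intro exI[of _ K]) simp_all
qed

end
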